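(* Let $p$ be a prime with $p\equiv 1\pmod 3$, let $q$ be a prime with $q\equiv 3\pmod 4$ such that $p$ is a quadratic residue modulo $q$. Then for $i=1,\dots,14$ the extended quadratic residue code $\overline{Q_i}$ of length $q+1$ over $\mathcal{R}$ (defined below) is self-dual.
   Context: $\mathcal{R}=\mathbb{F}_p+u\mathbb{F}_p+u^2\mathbb{F}_p+u^3\mathbb{F}_p$ with $u^4=u$; $\mathcal{R}_q=\mathcal{R}[x]/\langle x^q-1\rangle$, codes identified with ideals, $\langle\cdot\rangle$ the ideal generated; self-dual means $C=C^\perp$ for the Euclidean inner product. $\xi\in\mathbb{F}_p$ is a primitive cube root of unity; $\eta_1=1-u^3$, $\eta_2=3^{-1}(u+u^2+u^3)$, $\eta_3=3^{-1}(\xi u+\xi^2u^2+u^3)$, $\eta_4=3^{-1}(\xi^2u+\xi u^2+u^3)$. With $Q_q,N_q$ the quadratic residues/non-residues mod $q$, $j_1=\sum_{i\in Q_q}x^i$, $j_2=\sum_{i\in N_q}x^i$, $\alpha$ a primitive $q$-th root of unity over $\mathbb{F}_p$, $\chi$ the Legendre symbol mod $q$, $\theta=\sum_{i=1}^{q-1}\chi(i)\alpha^i\in\mathbb{F}_p$: $\tilde e_1=\frac12(1-\frac1q)-\frac12(\frac1q+\frac1\theta)j_1-\frac12(\frac1q-\frac1\theta)j_2$, $\tilde e_2=\frac12(1-\frac1q)-\frac12(\frac1q+\frac1\theta)j_2-\frac12(\frac1q-\frac1\theta)j_1$. For $i=1,2,3,4$: $S_i=\langle(1-\eta_i)\tilde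 e_1+\eta_i\tilde e_2\rangle$, $S_{i+4}=\langle\eta_i\tilde e_1+(1-\eta_i)\tilde e_2\rangle$; for $k=9,10,11$ with $(i,j)=(1,2),(1,3),(1,4)$: $S_k=\langle(\eta_i+\eta_j)\tilde e_1+(1-\eta_i-\eta_j)\tilde e_2\rangle$, $S_{k+3}=\langle(\eta_i+\eta_j)\tilde e_2+(1-\eta_i-\eta_j)\tilde e_1\rangle$. Let $r\in\mathbb{F}_p$ with $r^2=-q$ in $\mathbb{F}_p$ (under the hypotheses such $r$ exists). Coordinates of $\mathcal{R}^{q+1}$ are indexed by $\infty,0,1,\dots,q-1$. The extended code $\overline{Q_i}$ is the $\mathcal{R}$-submodule of $\mathcal{R}^{q+1}$ generated by the vectors $(0,c_0,\dots,c_{q-1})$ for $(c_0,\dots,c_{q-1})\in S_i$ together with the vector $(r,1,1,\dots,1)$. *)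

theory Defs
  imports
    "HOL-Algebra.Algebraic_Closure_Type"
    "HOL-Algebra.QuotRing"
    "HOL-Number_Theory.Residues"
    "Jordan_Normal_Form.VS_Connect"
    "Berlekamp_Zassenhaus.Finite_Field"
begin

section \<open>The ring $F[u]/(u^4-u)$\<close>

definition u_modulus :: "'a::field poly" where
  "u_modulus = [:0, -1, 0, 0, 1:]"

text \<open>The ring \<open>F + uF + u\<^sup>2F + u\<^sup>3F\<close> with \<open>u\<^sup>4 = u\<close>, as the quotient of \<open>F[X]\<close> by \<open>X\<^sup>4 - X\<close>.
  The lemmas \<open>u_pow4\<close> and \<open>uring_basis\<close> below confirm the description by coordinates.\<close>

quotient_type (overloaded) 'a uring =
  "'a::field poly" / "\<lambda>f g. u_modulus dvd (f - g)"
proof (rule equivpI)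
  show "reflp (\<lambda>f g :: 'a poly. u_modulus dvd (f - g))"
    by (rule reflpI) simp
  show "symp (\<lambda>f g :: 'a poly. u_modulus dvd (f - g))"
    by (rule sympI) (metis dvd_minus_iff minus_diff_eq)
  show "transp (\<lambda>f g :: 'a poly. u_modulus dvd (f - g))"
  proof (rule transpI)
    fix f g h :: "'a poly"
    assume "u_modulus dvd f - g" "u_modulus dvd g - h"
    then have "u_modulus dvd (f - g) + (g - h)" by (rule dvd_add)
    then show "u_modulus dvd f - h" by simp
  qed
qed

instantiation uring :: (field) comm_ring_1
begin

lift_definition zero_uring :: "'a uring" is 0 .
lift_definition one_uring :: "'a uring" is 1 .

lift_definition plus_uring :: "'a uring \<Rightarrow> 'a uring \<Rightarrow> 'a uring" is "(+)"
proof -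
  fix f f' g g' :: "'a poly"
  assume "u_modulus dvd f - f'" "u_modulus dvd g - g'"
  then have "u_modulus dvd (f - f') + (g - g')" by (rule dvd_add)
  then show "u_modulus dvd (f + g) - (f' + g')" by (simp add: algebra_simps)
qed

lift_definition uminus_uring :: "'a uring \<Rightarrow> 'a uring" is uminus
  by (metis dvd_minus_iff minus_diff_minus)

lift_definition minus_uring :: "'a uring \<Rightarrow> 'a uring \<Rightarrow> 'a uring" is "(-)"
proof -
  fix f f' g g' :: "'a poly"
  assume "u_modulus dvd f - f'" "u_modulus dvd g - g'"
  then have "u_modulus dvd (f - f') - (g - g')" by (rule dvd_diff)
  then show "u_modulus dvd (f - g) - (f' - g')" by (simp add: algebra_simps)
qed

lift_definition times_uring :: "'a uring \<Rightarrow> 'a uring \<Rightarrow> 'a uring" is "(*)"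
proof -
  fix f f' g g' :: "'a poly"
  assume "u_modulus dvd f - f'" "u_modulus dvd g - g'"
  then have "u_modulus dvd (f - f') * g + f' * (g - g')" by simp
  then show "u_modulus dvd f * g - f' * g'" by (simp add: algebra_simps)
qed

instance
proof
  show "(0 :: 'a uring) \<noteq> 1"
  proof (transfer, rule notI)
    assume "u_modulus dvd (0 - 1 :: 'a poly)"
    then have "degree (u_modulus :: 'a poly) \<le> degree (0 - 1 :: 'a poly)"
      by (rule dvd_imp_degree_le) simp
    then show False by (simp add: u_modulus_def)
  qed
qed (transfer; simp add: algebra_simps)+

end

lift_definition uconst :: "'a::field \<Rightarrow> 'a uring" is "\<lambda>c. [:c:]" .
lift_definition u :: "'a::field uring" is "[:0, 1:]" .

lemma u_pow4: "(u :: 'a::field uring) ^ 4 = u"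
proof -
  have "(u :: 'a uring) * u * u * u = u"
    by transfer (simp add: u_modulus_def)
  then show ?thesis by (simp add: power4_eq_xxxx)
qed

lemma uring_basis:
  fixes x :: "'a::field uring"
  shows "\<exists>!(a, b, c, d). x = uconst a + uconst b * u + uconst c * u ^ 2 + uconst d * u ^ 3"
proof -
  have repr: "uconst a + uconst b * u + uconst c * u ^ 2 + uconst d * u ^ 3
      = abs_uring [:a, b, c, d:]" for a b c d :: 'a
    by (simp add: uconst_def u_def power2_eq_square power3_eq_cube
        times_uring.abs_eq plus_uring.abs_eq)
  have deg: "degree (u_modulus :: 'a poly) = 4"
    by (simp add: u_modulus_def)
  have ex: "\<exists>a b c d. x = abs_uring [:a, b, c, d:]"
  proof -
    obtain f where f: "x = abs_uring f" by (metis Quotient_uring Quotient_abs_rep)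
    define g where "g = f mod u_modulus"
    have "x = abs_uring g"
      unfolding f g_def uring.abs_eq_iff by (metis dvd_minus_mod)
    moreover have "degree g < 4"
      using degree_mod_less[of "u_modulus :: 'a poly" f] deg
      by (auto simp: g_def u_modulus_def)
    then have "g = [:Polynomial.coeff g 0, Polynomial.coeff g 1, Polynomial.coeff g 2, Polynomial.coeff g 3:]"
      by (intro poly_eqI)
        (auto simp: coeff_pCons coeff_eq_0 eval_nat_numeral split: nat.splits)
    ultimately show ?thesis by metis
  qed
  have un: "[:a, b, c, d:] = [:a', b', c', d':]"
    if "abs_uring [:a, b, c, d:] = abs_uring [:a', b', c', d':]" for a b c d a' b' c' d' :: 'a
  proof (rule ccontr)
    let ?h = "[:a, b, c, d:] - [:a', b', c', d':]"
    assume "\<not> ?thesis"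
    then have "?h \<noteq> 0" by simp
    moreover from that have "u_modulus dvd ?h" by (simp only: uring.abs_eq_iff)
    ultimately have "degree (u_modulus :: 'a poly) \<le> degree ?h"
      by (rule dvd_imp_degree_le[rotated])
    moreover have "degree ?h \<le> 3"
      by (rule degree_le) (auto simp: coeff_pCons split: nat.splits)
    ultimately show False using deg by simp
  qed
  from ex un show ?thesis unfolding repr by auto blast+
qed


section \<open>Idempotents\<close>

definition primitive_root_of_unity :: "nat \<Rightarrow> 'a::field \<Rightarrow> bool" where
  "primitive_root_of_unity n z \<longleftrightarrow> n > 0 \<and> z ^ n = 1 \<and> (\<forall>k. 0 < k \<and> k < n \<longrightarrow> z ^ k \<noteq> 1)"

text \<open>Only the values at \<open>1, 2, 3, 4\<close> are meaningful.\<close>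

definition eta :: "'a::field \<Rightarrow> nat \<Rightarrow> 'a uring" where
  "eta \<xi> i =
    (if i = 1 then 1 - u ^ 3
     else if i = 2 then uconst (inverse 3) * (u + u ^ 2 + u ^ 3)
     else if i = 3 then uconst (inverse 3) * (uconst \<xi> * u + uconst (\<xi> ^ 2) * u ^ 2 + u ^ 3)
     else if i = 4 then uconst (inverse 3) * (uconst (\<xi> ^ 2) * u + uconst \<xi> * u ^ 2 + u ^ 3)
     else 0)"

definition quad_residues :: "nat \<Rightarrow> nat set" where
  "quad_residues q = {i \<in> {1..<q}. QuadRes (int q) (int i)}"

definition quad_nonresidues :: "nat \<Rightarrow> nat set" where
  "quad_nonresidues q = {i \<in> {1..<q}. \<not> QuadRes (int q) (int i)}"

definition j1 :: "nat \<Rightarrow> 'a::field poly" where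
  "j1 q = (\<Sum>i\<in>quad_residues q. Polynomial.monom 1 i)"

definition j2 :: "nat \<Rightarrow> 'a::field poly" where
  "j2 q = (\<Sum>i\<in>quad_nonresidues q. Polynomial.monom 1 i)"

text \<open>The Gauss sum is formed in the algebraic closure and then read as an element of the base
  field by \<open>of_ac\<close>, which is the inverse of the embedding \<open>to_ac\<close> on its range and \<open>0\<close> elsewhere;
  the sum does lie in the base field \<open>\<int>/p\<close> when \<open>p\<close> is a quadratic residue modulo \<open>q\<close>.\<close>

definition gauss_sum :: "nat \<Rightarrow> 'a::field alg_closure \<Rightarrow> 'a" where
  "gauss_sum q \<alpha> = of_ac (\<Sum>i = 1..q - 1. of_int (Legendre (int i) (int q)) * \<alpha> ^ i)"

definition e1 :: "nat \<Rightarrow> 'a::field \<Rightarrow> 'a poly" where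
  "e1 q \<theta> = [: 1/2 * (1 - 1 / of_nat q) :]
     - [: 1/2 * (1 / of_nat q + 1 / \<theta>) :] * j1 q
     - [: 1/2 * (1 / of_nat q - 1 / \<theta>) :] * j2 q"

definition e2 :: "nat \<Rightarrow> 'a::field \<Rightarrow> 'a poly" where
  "e2 q \<theta> = [: 1/2 * (1 - 1 / of_nat q) :]
     - [: 1/2 * (1 / of_nat q + 1 / \<theta>) :] * j2 q
     - [: 1/2 * (1 / of_nat q - 1 / \<theta>) :] * j1 q"

text \<open>For \<open>i = 9, 10, 11\<close> and for \<open>i = 12, 13, 14\<close> the second index \<open>i - 7\<close> resp. \<open>i - 10\<close>
  runs through \<open>2, 3, 4\<close>.\<close>

definition qr_gen :: "nat \<Rightarrow> 'a::field \<Rightarrow> 'a \<Rightarrow> nat \<Rightarrow> 'a uring poly" where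
  "qr_gen q \<xi> \<theta> i =
    (let E1 = map_poly uconst (e1 q \<theta>); E2 = map_poly uconst (e2 q \<theta>) in
     if i \<in> {1..4} then [:1 - eta \<xi> i:] * E1 + [:eta \<xi> i:] * E2
     else if i \<in> {5..8} then [:eta \<xi> (i - 4):] * E1 + [:1 - eta \<xi> (i - 4):] * E2
     else if i \<in> {9..11} then
       [:eta \<xi> 1 + eta \<xi> (i - 7):] * E1 + [:1 - eta \<xi> 1 - eta \<xi> (i - 7):] * E2
     else if i \<in> {12..14} then
       [:eta \<xi> 1 + eta \<xi> (i - 10):] * E2 + [:1 - eta \<xi> 1 - eta \<xi> (i - 10):] * E1
     else 0)"


section \<open>Cyclic codes as ideals\<close>

definition cyc_ideal :: "nat \<Rightarrow> 'a::field uring poly set" where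
  "cyc_ideal q = Idl\<^bsub>class_ring\<^esub> {Polynomial.monom 1 q - 1}"

definition cyc_ring :: "nat \<Rightarrow> 'a::field uring poly set ring" where
  "cyc_ring q = class_ring Quot (cyc_ideal q)"

definition cyc_class :: "nat \<Rightarrow> 'a::field uring poly \<Rightarrow> 'a uring poly set" where
  "cyc_class q f = cyc_ideal q +>\<^bsub>class_ring\<^esub> f"

text \<open>The vector \<open>(c\<^sub>0, \<dots>, c\<^bsub>q-1\<^esub>)\<close> is identified with the class of \<open>c\<^sub>0 + c\<^sub>1 x + \<dots> + c\<^bsub>q-1\<^esub> x\<^bsup>q-1\<^esup>\<close>.\<close>

definition code_of_ideal :: "nat \<Rightarrow> 'a::field uring poly set set \<Rightarrow> 'a uring vec set" where
  "code_of_ideal q I =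
    {c \<in> carrier_vec q. cyc_class q (\<Sum>i<q. Polynomial.monom (c $ i) i) \<in> I}"

definition qr_code :: "nat \<Rightarrow> 'a::field \<Rightarrow> 'a alg_closure \<Rightarrow> nat \<Rightarrow> 'a uring vec set" where
  "qr_code q \<xi> \<alpha> i =
    code_of_ideal q (Idl\<^bsub>cyc_ring q\<^esub> {cyc_class q (qr_gen q \<xi> (gauss_sum q \<alpha>) i)})"

text \<open>Position \<open>0\<close> of a vector of length \<open>q + 1\<close> is the coordinate \<open>\<infinity>\<close>, and position \<open>i + 1\<close>
  is the coordinate \<open>i\<close>.\<close>

definition extended_qr_code ::
    "nat \<Rightarrow> 'a::field \<Rightarrow> 'a alg_closure \<Rightarrow> 'a \<Rightarrow> nat \<Rightarrow> 'a uring vec set" where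
  "extended_qr_code q \<xi> \<alpha> r i =
    LinearCombinations.module.span class_ring (module_vec TYPE('a uring) (q + 1))
      (vCons 0 ` qr_code q \<xi> \<alpha> i \<union> {vCons (uconst r) (vec q (\<lambda>_. 1))})"

definition dual_code :: "nat \<Rightarrow> 'a::comm_ring_1 vec set \<Rightarrow> 'a vec set" where
  "dual_code n C = {v \<in> carrier_vec n. \<forall>w\<in>C. scalar_prod v w = 0}"

definition self_dual :: "nat \<Rightarrow> 'a::comm_ring_1 vec set \<Rightarrow> bool" where
  "self_dual n C \<longleftrightarrow> C = dual_code n C"

end

theory Submission
  imports Defs "HOL-Number_Theory.Euler_Criterion"
begin

text \<open>Let \<open>J = \<Sum>\<^sub>i x\<^sup>i\<close> and \<open>L = \<Sum>\<^sub>i \<chi>(i) x\<^sup>i\<close>, where \<open>\<chi>\<close> is the Legendre symbol modulo \<open>q\<close>.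
  Modulo \<open>x\<^sup>q - 1\<close> one has \<open>L\<^sup>2 = J - q\<close> and \<open>J\<^sup>2 = q J\<close>, and the reversal
  \<open>x \<mapsto> 1/x\<close> fixes \<open>J\<close> and negates \<open>L\<close>, because \<open>-1\<close> is a non-residue. Evaluating \<open>L\<^sup>2 = J - q\<close> at \<open>\<alpha>\<close>
  gives \<open>\<theta>\<^sup>2 = -q\<close>, so \<open>\<theta> = \<plusminus>r\<close> lies in the base field. All fourteen generators have the form
  \<open>f e\<^sub>1 + (1 - f) e\<^sub>2 = (1 - J/q)/2 - g L\<close> with \<open>f\<close> idempotent and \<open>g\<^sup>2 = -1/(4q)\<close>. For such an
  element \<open>E\<close> with reversal \<open>E'\<close> the relations above give \<open>E E' = 0\<close> and \<open>E + E' = 1 - J/q\<close>: the former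
  makes the code self-orthogonal, the latter shows that its dual exceeds it only by constant words.\<close>

section \<open>The Legendre symbol modulo \<open>q\<close> and multiplication of nonzero
  residues\<close>

lemma Legendre_cong:
  assumes "[a = b] (mod q)"
  shows "Legendre a q = Legendre b q"
proof -
  have "[c = a] (mod q) \<longleftrightarrow> [c = b] (mod q)" for c
    using assms cong_sym cong_trans by blast
  then show ?thesis
    unfolding Legendre_def QuadRes_def by (simp add: cong_sym_eq[of _ 0])
qed

lemma Legendre_values: "Legendre a q \<in> {-1, 0, 1}"
  by (simp add: Legendre_def)

text \<open>Values in {-1, 0, 1} differ by at most 2, which is less than \<open>q\<close>. This
  turns the congruences of Euler's criterion into equalities of Legendre symbols.\<close>

lemma small_cong_imp_eq:
  fixes a b q :: int
  assumes "2 < q" "a \<in> {-1, 0, 1}" "b \<in> {-1, 0, 1}" "[a = b] (mod q)"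
  shows "a = b"
proof (rule ccontr)
  assume "a \<noteq> b"
  then have "q \<le> \<bar>a - b\<bar>"
    using assms(4) dvd_imp_le_int[of "a - b" q] assms(1) by (simp add: cong_iff_dvd_diff)
  then show False using assms(1-3) by auto
qed

lemma Legendre_mult:
  assumes "prime q" "2 < q"
  shows "Legendre (a * b) (int q) = Legendre a q * Legendre b q"
proof (rule small_cong_imp_eq)
  show "2 < int q" using assms by simp
  have "[Legendre a q * Legendre b q = a ^ ((q - 1) div 2) * b ^ ((q - 1) div 2)] (mod q)"
    using assms by (intro cong_mult euler_criterion)
  then show "[Legendre (a * b) (int q) = Legendre a q * Legendre b q] (mod q)"
    using euler_criterion[OF assms, of "a * b"]
    by (metis cong_sym cong_trans power_mult_distrib)
qed (use Legendre_values[of a q] Legendre_values[of b q] Legendre_values[of "a * b" q] in auto)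

text \<open>Euler's criterion gives (-1)^((q-1)/2), whose exponent is odd when \<open>q\<close> is 3
  modulo 4.\<close>

lemma Legendre_minus_one:
  assumes "prime q" "q mod 4 = 3"
  shows "Legendre (-1) (int q) = -1"
proof (rule small_cong_imp_eq)
  have q: "2 < q" using assms prime_ge_2_nat[of q] by (cases "q = 2") auto
  then show "2 < int q" by simp
  have "odd ((q - 1) div 2)" using assms(2) by presburger
  then show "[Legendre (-1) (int q) = -1] (mod q)"
    using euler_criterion[OF assms(1) q, of "-1"] by simp
qed (use Legendre_values[of "-1" q] in auto)

lemma bij_betw_mult_mod:
  assumes "prime q" "\<not> q dvd a"
  shows "bij_betw (\<lambda>i. a * i mod q) {1..<q} {1..<q :: nat}"
proof -
  have inj: "inj_on (\<lambda>i. a * i mod q) {1..<q}"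
  proof (rule inj_onI)
    fix i j assume ij: "i \<in> {1..<q}" "j \<in> {1..<q}" "a * i mod q = a * j mod q"
    then have "[a * i = a * j] (mod q)" by (simp add: cong_def)
    moreover have "coprime a q"
      using assms by (metis coprime_commute prime_imp_coprime)
    ultimately have "[i = j] (mod q)" by (simp add: cong_mult_lcancel_nat)
    then show "i = j" using ij by (simp add: cong_def)
  qed
  have sub: "(\<lambda>i. a * i mod q) ` {1..<q} \<subseteq> {1..<q}"
  proof safe
    fix i assume "i \<in> {1..<q}"
    then have "\<not> q dvd a * i"
      using assms by (simp add: prime_dvd_mult_iff nat_dvd_not_less)
    then show "a * i mod q \<in> {1..<q}"
      using prime_gt_0_nat[OF assms(1)] by (simp add: Suc_le_eq mod_greater_zero_iff_not_dvd)
  qed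
  show ?thesis using inj sub by (simp add: bij_betw_def endo_inj_surj)
qed

lemma sum_mult_mod:
  fixes f :: "nat \<Rightarrow> 'b::comm_monoid_add"
  assumes "prime q" "\<not> q dvd a"
  shows "(\<Sum>i=1..<q. f (a * i mod q)) = (\<Sum>i=1..<q. f i)"
  using sum.reindex_bij_betw[OF bij_betw_mult_mod[OF assms]] .

section \<open>Congruence modulo $x^q - 1$\<close>

text \<open>Congruence of polynomials stands in for equality in the quotient ring, so that
  calculations stay in the type of polynomials; \<open>cyc_class_eq_iff\<close> links the
  two.\<close>

definition cyc_eq :: "nat \<Rightarrow> 'a::comm_ring_1 poly \<Rightarrow> 'a poly \<Rightarrow> bool" where
  "cyc_eq q f g \<longleftrightarrow> Polynomial.monom 1 q - 1 dvd f - g"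

lemma cyc_eq_refl [simp]: "cyc_eq q f f"
  by (simp add: cyc_eq_def)

lemma cyc_eq_sym: "cyc_eq q f g \<Longrightarrow> cyc_eq q g f"
  unfolding cyc_eq_def by (metis dvd_minus_iff minus_diff_eq)

lemma cyc_eq_add:
  assumes "cyc_eq q f g" "cyc_eq q f' g'"
  shows "cyc_eq q (f + f') (g + g')"
proof -
  have "(f + f') - (g + g') = (f - g) + (f' - g')" by simp
  then show ?thesis using assms dvd_add unfolding cyc_eq_def by metis
qed

lemma cyc_eq_diff:
  assumes "cyc_eq q f g" "cyc_eq q f' g'"
  shows "cyc_eq q (f - f') (g - g')"
proof -
  have "(f - f') - (g - g') = (f - g) - (f' - g')" by simp
  then show ?thesis using assms dvd_diff unfolding cyc_eq_def by metis
qed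

lemma cyc_eq_trans [trans]:
  assumes "cyc_eq q f g" "cyc_eq q g h"
  shows "cyc_eq q f h"
  using dvd_add[OF assms[unfolded cyc_eq_def]] by (simp add: cyc_eq_def)

lemma cyc_eq_mult:
  assumes "cyc_eq q f g" "cyc_eq q f' g'"
  shows "cyc_eq q (f * f') (g * g')"
proof -
  have "Polynomial.monom 1 q - 1 dvd (f - g) * f' + g * (f' - g')"
    using assms by (simp add: cyc_eq_def)
  then show ?thesis by (simp add: cyc_eq_def algebra_simps)
qed

lemma cyc_eq_sum: "(\<And>i. i \<in> A \<Longrightarrow> cyc_eq q (f i) (g i)) \<Longrightarrow> cyc_eq q (sum f A) (sum g A)"
  by (induction A rule: infinite_finite_induct) (auto intro: cyc_eq_add)

lemma cyc_eq_monom_mod: "cyc_eq q (Polynomial.monom a n) (Polynomial.monom a (n mod q))"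
proof -
  have "Polynomial.monom 1 q - 1 dvd Polynomial.monom (1::'a) q ^ (n div q) - 1"
    by (simp add: power_diff_1_eq)
  then have "Polynomial.monom 1 q - 1 dvd
      Polynomial.monom a (n mod q) * (Polynomial.monom 1 q ^ (n div q) - 1)"
    by (rule dvd_mult)
  also have "\<dots> = Polynomial.monom a n - Polynomial.monom a (n mod q)"
    by (simp add: monom_power mult_monom algebra_simps)
  finally show ?thesis by (simp add: cyc_eq_def)
qed

lemma cyc_eq_monom: "m mod q = n mod q \<Longrightarrow> cyc_eq q (Polynomial.monom a m) (Polynomial.monom a n)"
  by (metis cyc_eq_monom_mod cyc_eq_sym cyc_eq_trans)

text \<open>Additive statements about polynomials need to be checked on monomials only.\<close>

lemma poly_monom_induct [case_names monom add]:
  assumes "\<And>a n. P (Polynomial.monom a n)" "\<And>f g. P f \<Longrightarrow> P g \<Longrightarrow> P (f + g)"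
  shows "P f"
proof -
  have "P 0" using assms(1)[of 0 0] by simp
  then have "P (sum g A)" if "\<And>i. P (g i)" for g and A :: "nat set"
    using assms(2) that by (induction A rule: infinite_finite_induct) auto
  then have "P (\<Sum>i\<le>Polynomial.degree f. Polynomial.monom (Polynomial.coeff f i) i)" using assms(1) by simp
  then show ?thesis by (simp add: poly_as_sum_of_monoms)
qed

text \<open>For \<open>k < q\<close> this is the \<open>k\<close>-th coefficient of the remainder
  modulo x^q - 1. Folding exponents modulo \<open>q\<close> avoids polynomial division over a ring
  that need not be a field.\<close>

definition cyc_coeff :: "nat \<Rightarrow> nat \<Rightarrow> 'a::comm_ring_1 poly \<Rightarrow> 'a" where
  "cyc_coeff q k f = (\<Sum>i\<le>Polynomial.degree f. if i mod q = k then Polynomial.coeff f i else 0)"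

text \<open>A free upper bound lets summands of different degrees share one index range, as
  additivity requires.\<close>

lemma cyc_coeff_eq_sum:
  assumes "Polynomial.degree f \<le> n"
  shows "cyc_coeff q k f = (\<Sum>i\<le>n. if i mod q = k then Polynomial.coeff f i else 0)"
  unfolding cyc_coeff_def
  by (rule sum.mono_neutral_left) (use assms in \<open>auto simp: coeff_eq_0\<close>)

lemma cyc_coeff_add [simp]: "cyc_coeff q k (f + g) = cyc_coeff q k f + cyc_coeff q k g"
proof -
  let ?n = "max (Polynomial.degree f) (Polynomial.degree g)"
  have deg: "Polynomial.degree (f + g) \<le> ?n" by (rule degree_add_le_max)
  show ?thesis
    unfolding cyc_coeff_eq_sum[OF deg]
      cyc_coeff_eq_sum[OF max.cobounded1[of "Polynomial.degree f" "Polynomial.degree g"]]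
      cyc_coeff_eq_sum[OF max.cobounded2[of "Polynomial.degree g" "Polynomial.degree f"]]
      sum.distrib[symmetric] by (intro sum.cong) auto
qed

lemma cyc_coeff_monom [simp]:
  "cyc_coeff q k (Polynomial.monom a n) = (if n mod q = k then a else 0)"
proof -
  have "cyc_coeff q k (Polynomial.monom a n)
      = (\<Sum>i\<le>n. if i = n then if n mod q = k then a else 0 else 0)"
    unfolding cyc_coeff_eq_sum[OF degree_monom_le] by (intro sum.cong refl) auto
  then show ?thesis by simp
qed

lemma cyc_coeff_0 [simp]: "cyc_coeff q k 0 = 0"
  by (simp add: cyc_coeff_def)

lemma cyc_coeff_diff [simp]: "cyc_coeff q k (f - g) = cyc_coeff q k f - cyc_coeff q k g"
  using cyc_coeff_add[of q k "f - g" g] by (simp add: algebra_simps)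

lemma cyc_coeff_sum: "cyc_coeff q k (sum f A) = (\<Sum>i\<in>A. cyc_coeff q k (f i))"
  by (induction A rule: infinite_finite_induct) auto

text \<open>Multiplication by x^q preserves exponents modulo \<open>q\<close>, so multiples of x^q -
  1 have only zero folded coefficients.\<close>

lemma cyc_coeff_cong:
  assumes "cyc_eq q f g"
  shows "cyc_coeff q k f = cyc_coeff q k g"
proof -
  obtain h where h: "f - g = (Polynomial.monom 1 q - 1) * h" using assms by (auto simp: cyc_eq_def)
  have "cyc_coeff q k (Polynomial.monom 1 q * h) = cyc_coeff q k h"
    by (induction h rule: poly_monom_induct) (auto simp: mult_monom distrib_left)
  then have "cyc_coeff q k (f - g) = 0" unfolding h by (simp add: algebra_simps)
  then show ?thesis by simp
qed

lemma cyc_eq_reduced: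
  assumes "q > 0"
  shows "cyc_eq q f (\<Sum>k<q. Polynomial.monom (cyc_coeff q k f) k)"
proof (induction f rule: poly_monom_induct)
  case (monom a n)
  have "(\<Sum>k<q. Polynomial.monom (cyc_coeff q k (Polynomial.monom a n)) k)
      = (\<Sum>k<q. if k = n mod q then Polynomial.monom a (n mod q) else 0)"
    by (intro sum.cong) auto
  then show ?case using assms by (simp add: cyc_eq_monom_mod)
next
  case (add f g)
  then show ?case by (auto simp: add_monom[symmetric] sum.distrib intro: cyc_eq_add)
qed

section \<open>The reversal $x \mapsto x^{-1}$\<close>

text \<open>Modulo x^q - 1 the monomial x^(q-1) is the inverse of x, so the reversal becomes a
  substitution and is a ring homomorphism before any reduction.\<close>

definition cyc_rev :: "nat \<Rightarrow> 'a::comm_ring_1 poly \<Rightarrow> 'a poly" where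
  "cyc_rev q f = pcompose f (Polynomial.monom 1 (q - 1))"

lemma cyc_rev_add: "cyc_rev q (f + g) = cyc_rev q f + cyc_rev q g"
  and cyc_rev_diff: "cyc_rev q (f - g) = cyc_rev q f - cyc_rev q g"
  and cyc_rev_mult: "cyc_rev q (f * g) = cyc_rev q f * cyc_rev q g"
  and cyc_rev_sum: "cyc_rev q (sum F A) = (\<Sum>i\<in>A. cyc_rev q (F i))"
  and cyc_rev_const [simp]: "cyc_rev q [:a:] = [:a:]"
  by (simp_all add: cyc_rev_def pcompose_add pcompose_diff pcompose_mult pcompose_sum)

lemma cyc_rev_1 [simp]: "cyc_rev q 1 = 1"
  by (simp add: cyc_rev_def pcompose_1)

lemma cyc_rev_monom: "cyc_rev q (Polynomial.monom a n) = Polynomial.monom a ((q - 1) * n)"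
proof -
  have "Polynomial.monom a n = [:a:] * Polynomial.monom 1 1 ^ n"
    by (simp add: monom_power smult_monom)
  then have "cyc_rev q (Polynomial.monom a n) = [:a:] * cyc_rev q (Polynomial.monom 1 1 ^ n)"
    by (simp only: cyc_rev_mult cyc_rev_const)
  moreover have "cyc_rev q (Polynomial.monom 1 1) = Polynomial.monom 1 (q - 1)"
    by (simp add: cyc_rev_def monom_altdef pcompose_pCons)
  moreover have "cyc_rev q (f ^ n) = cyc_rev q f ^ n" for f :: "'a poly"
    by (induction n) (auto simp: cyc_rev_mult)
  ultimately have "cyc_rev q (Polynomial.monom a n) = [:a:] * Polynomial.monom 1 (q - 1) ^ n"
    by metis
  then show ?thesis by (simp add: monom_power smult_monom)
qed

text \<open>The substitution sends x^q - 1 to x^((q-1)q) - 1, again a multiple of x^q - 1.\<close>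

lemma cyc_eq_rev:
  assumes "cyc_eq q f g"
  shows "cyc_eq q (cyc_rev q f) (cyc_rev q g)"
proof -
  obtain h where h: "f - g = (Polynomial.monom 1 q - 1) * h" using assms by (auto simp: cyc_eq_def)
  have "cyc_eq q (Polynomial.monom 1 ((q - 1) * q)) (Polynomial.monom (1::'a) 0)"
    by (rule cyc_eq_monom) simp
  then have "Polynomial.monom 1 q - 1 dvd cyc_rev q (Polynomial.monom (1::'a) q - 1)"
    by (simp add: cyc_eq_def cyc_rev_diff cyc_rev_monom)
  moreover have "cyc_rev q f - cyc_rev q g = cyc_rev q (Polynomial.monom 1 q - 1) * cyc_rev q h"
    using h by (metis cyc_rev_diff cyc_rev_mult)
  ultimately show ?thesis by (simp add: cyc_eq_def)
qed

section \<open>The character polynomial\<close>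

definition ones_poly :: "nat \<Rightarrow> 'a::comm_ring_1 poly" where
  "ones_poly q = (\<Sum>i<q. Polynomial.monom 1 i)"

text \<open>The formal quadratic Gauss sum: its value at a \<open>q\<close>-th root of unity is the
  usual one.\<close>

definition Legendre_poly :: "nat \<Rightarrow> 'a::comm_ring_1 poly" where
  "Legendre_poly q = (\<Sum>i=1..<q. Polynomial.monom (of_int (Legendre (int i) (int q))) i)"

lemma ones_poly_split:
  assumes "q > 0"
  shows "ones_poly q = 1 + (\<Sum>i=1..<q. Polynomial.monom 1 i)"
proof -
  have "{..<q} = insert 0 {1..<q}" using assms by auto
  then show ?thesis by (simp add: ones_poly_def)
qed

text \<open>Since x^q - 1 = (x - 1) J, multiplication by x fixes J modulo x^q - 1, and so any
  polynomial acts on J through its value at 1.\<close>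

lemma cyc_eq_mult_ones_poly: "cyc_eq q (f * ones_poly q) ([:poly f 1:] * ones_poly q)"
proof (induction f rule: poly_monom_induct)
  case (monom a n)
  have "Polynomial.monom (1::'a) q - 1 = (Polynomial.monom 1 1 - 1) * ones_poly q"
    using power_diff_1_eq[of "Polynomial.monom (1::'a) 1" q] by (simp add: monom_power ones_poly_def)
  moreover have "Polynomial.monom (1::'a) 1 - 1 dvd Polynomial.monom 1 n - 1"
    using power_diff_1_eq[of "Polynomial.monom (1::'a) 1" n] by (simp add: monom_power)
  ultimately have "Polynomial.monom (1::'a) q - 1 dvd (Polynomial.monom 1 n - 1) * ones_poly q"
    by (simp add: mult_dvd_mono)
  then have "cyc_eq q (Polynomial.monom 1 n * ones_poly q) (ones_poly q :: 'a poly)"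
    by (simp add: cyc_eq_def algebra_simps)
  from cyc_eq_mult[OF cyc_eq_refl[of q "[:a:]"] this] show ?case
    by (simp add: poly_monom smult_monom flip: mult_smult_left)
next
  case (add f g)
  then have "cyc_eq q ((f + g) * ones_poly q) ([:poly f 1:] * ones_poly q + [:poly g 1:] * ones_poly q)"
    unfolding distrib_right by (rule cyc_eq_add)
  then show ?case by (simp add: smult_add_left)
qed

lemma poly_ones_poly_1: "poly (ones_poly q) 1 = of_nat q"
  by (simp add: ones_poly_def poly_sum poly_monom)

context
  fixes q :: nat
  assumes q: "prime q" "q mod 4 = 3"
begin

private abbreviation \<chi> :: "nat \<Rightarrow> int" where "\<chi> i \<equiv> Legendre (int i) (int q)"

private lemma q3: "2 < q"
  using q prime_ge_2_nat[of q] by (cases "q = 2") auto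

private lemma chi_mod: "\<chi> (i mod q) = \<chi> i"
  by (rule Legendre_cong) (simp add: cong_def zmod_int)

private lemma chi_mult: "\<chi> (i * j) = \<chi> i * \<chi> j"
  using Legendre_mult[OF q(1) q3] by simp

private lemma chi_neg: "\<chi> (q - 1) = -1"
  using Legendre_minus_one[OF q] q3 Legendre_cong[of "int (q - 1)" "-1" q]
  by (simp add: cong_iff_dvd_diff of_nat_diff)

private lemma chi_sq: "i \<in> {1..<q} \<Longrightarrow> \<chi> i * \<chi> i = 1"
  by (simp add: Legendre_def cong_iff_dvd_diff nat_dvd_not_less)

private lemma not_dvd_neg: "\<not> q dvd q - 1"
  using q3 by (simp add: nat_dvd_not_less)

text \<open>Replacing \<open>i\<close> by \<open>-i\<close> permutes the summands and changes every
  sign, so the sum equals its own negative.\<close>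

lemma sum_Legendre: "(\<Sum>i=1..<q. Legendre (int i) (int q)) = 0"
proof -
  have "(\<Sum>i=1..<q. \<chi> i) = (\<Sum>i=1..<q. \<chi> ((q - 1) * i mod q))"
    by (rule sum_mult_mod[OF q(1) not_dvd_neg, symmetric])
  also have "\<dots> = - (\<Sum>i=1..<q. \<chi> i)"
    unfolding chi_mod chi_mult chi_neg by (simp add: sum_negf)
  finally show ?thesis by simp
qed

lemma poly_Legendre_poly_1: "poly (Legendre_poly q) (1::'a::comm_ring_1) = 0"
proof -
  have "poly (Legendre_poly q) (1::'a) = of_int (\<Sum>i=1..<q. \<chi> i)"
    by (simp add: Legendre_poly_def poly_sum poly_monom)
  then show ?thesis by (simp only: sum_Legendre of_int_0)
qed

lemma cyc_rev_ones_poly: "cyc_eq q (cyc_rev q (ones_poly q)) (ones_poly q :: 'a::comm_ring_1 poly)"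
proof -
  have "q > 0" using q3 by simp
  have "cyc_eq q (\<Sum>i=1..<q. Polynomial.monom (1::'a) ((q - 1) * i))
      (\<Sum>i=1..<q. Polynomial.monom 1 ((q - 1) * i mod q))"
    by (intro cyc_eq_sum cyc_eq_monom_mod)
  then show ?thesis
    unfolding ones_poly_split[OF \<open>q > 0\<close>] cyc_rev_add cyc_rev_sum cyc_rev_monom
      sum_mult_mod[OF q(1) not_dvd_neg] by (auto intro: cyc_eq_add)
qed

text \<open>The reversal permutes the nonzero exponents by multiplication with -1, a non-residue,
  which flips the sign of each coefficient.\<close>

lemma cyc_rev_Legendre_poly:
  "cyc_eq q (cyc_rev q (Legendre_poly q)) (- Legendre_poly q :: 'a::comm_ring_1 poly)"
proof -
  have "cyc_eq q (cyc_rev q (Legendre_poly q))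
      (\<Sum>i=1..<q. Polynomial.monom (of_int (\<chi> i) :: 'a) ((q - 1) * i mod q))"
    unfolding Legendre_poly_def cyc_rev_sum cyc_rev_monom by (intro cyc_eq_sum cyc_eq_monom_mod)
  also have "(\<Sum>i=1..<q. Polynomial.monom (of_int (\<chi> i) :: 'a) ((q - 1) * i mod q))
      = (\<Sum>i=1..<q. Polynomial.monom (of_int (- \<chi> ((q - 1) * i mod q))) ((q - 1) * i mod q))"
    unfolding chi_mod chi_mult chi_neg by simp
  also have "\<dots> = - Legendre_poly q"
    unfolding sum_mult_mod[OF q(1) not_dvd_neg, of "\<lambda>j. Polynomial.monom (of_int (- \<chi> j)) j"]
    by (simp add: Legendre_poly_def sum_negf flip: minus_monom)
  finally show ?thesis .
qed

text \<open>Substituting \<open>j = i k\<close> in the double sum makes the inner sum over \<open>i\<close> equal to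
  \<open>\<chi>(k) \<Sum>\<^sub>i x\<^bsup>i(1+k)\<^esup>\<close>, which only depends on \<open>k\<close> through whether \<open>k = -1\<close>.\<close>

lemma Legendre_poly_square:
  "cyc_eq q (Legendre_poly q * Legendre_poly q) (ones_poly q - of_nat q :: 'a::comm_ring_1 poly)"
proof -
  let ?m = "\<lambda>a n. Polynomial.monom (of_int a :: 'a) n"
  let ?J = "\<Sum>i=1..<q. Polynomial.monom (1::'a) i"
  have "Legendre_poly q * Legendre_poly q = (\<Sum>i=1..<q. \<Sum>j=1..<q. ?m (\<chi> i * \<chi> j) (i + j))"
    by (simp add: Legendre_poly_def sum_product mult_monom)
  also have "\<dots> = (\<Sum>i=1..<q. \<Sum>k=1..<q. ?m (\<chi> i * \<chi> (i * k mod q)) (i + i * k mod q))"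
  proof (rule sum.cong[OF refl])
    fix i assume "i \<in> {1..<q}"
    then have "\<not> q dvd i" by (simp add: nat_dvd_not_less)
    from sum_mult_mod[OF q(1) this, of "\<lambda>j. ?m (\<chi> i * \<chi> j) (i + j)"]
    show "(\<Sum>j=1..<q. ?m (\<chi> i * \<chi> j) (i + j))
        = (\<Sum>k=1..<q. ?m (\<chi> i * \<chi> (i * k mod q)) (i + i * k mod q))" by simp
  qed
  also have "\<dots> = (\<Sum>i=1..<q. \<Sum>k=1..<q. ?m (\<chi> k) (i + i * k mod q))"
    unfolding chi_mod chi_mult mult.assoc[symmetric] by (intro sum.cong refl) (simp add: chi_sq)
  also have "cyc_eq q \<dots> (\<Sum>i=1..<q. \<Sum>k=1..<q. ?m (\<chi> k) ((1 + k) * i mod q))"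
    by (intro cyc_eq_sum cyc_eq_monom) (simp add: algebra_simps mod_simps)
  also have "(\<Sum>i=1..<q. \<Sum>k=1..<q. ?m (\<chi> k) ((1 + k) * i mod q))
      = (\<Sum>k=1..<q. \<Sum>i=1..<q. ?m (\<chi> k) ((1 + k) * i mod q))"
    by (rule sum.swap)
  \<comment> \<open>For \<open>k = q - 1\<close> all exponents are 0 and the inner sum is -(q - 1).
    Writing it as \<open>- ?J\<close> plus a correction leaves multiples of \<open>?J\<close> whose
    coefficients add up to 0 by \<open>sum_Legendre\<close>.\<close>
  also have "\<dots> = (\<Sum>k=1..<q. of_int (\<chi> k) * ?J + (if k = q - 1 then ?J - of_nat (q - 1) else 0))"
  proof (rule sum.cong[OF refl])
    fix k assume k: "k \<in> {1..<q}"
    show "(\<Sum>i=1..<q. ?m (\<chi> k) ((1 + k) * i mod q))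
        = of_int (\<chi> k) * ?J + (if k = q - 1 then ?J - of_nat (q - 1) else 0)"
    proof (cases "k = q - 1")
      case True
      then have "1 + k = q" "\<chi> k = -1" using k chi_neg by simp_all
      then show ?thesis using True by (simp add: monom_0 of_nat_poly)
    next
      case False
      then have "\<not> q dvd 1 + k" using k by (intro nat_dvd_not_less) auto
      from sum_mult_mod[OF q(1) this, of "?m (\<chi> k)"] False show ?thesis
        by (simp add: sum_distrib_left of_int_poly smult_monom)
    qed
  qed
  also have "\<dots> = of_int (\<Sum>k=1..<q. \<chi> k) * ?J + (?J - of_nat (q - 1))"
  proof -
    have "q - 1 \<in> {1..<q}" using q3 by auto
    then show ?thesis by (simp only: sum.distrib of_int_sum sum_distrib_right) simp
  qed
  \<comment> \<open>\<open>?J\<close> lacks the constant term 1 of \<open>ones_poly q\<close>; this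
    turns \<open>q - 1\<close> into \<open>q\<close>.\<close>
  also have "\<dots> = ones_poly q - of_nat q"
    unfolding sum_Legendre using q3 ones_poly_split[of q, where ?'a = 'a] by (simp add: of_nat_diff)
  finally show ?thesis .
qed

end

section \<open>Cyclic codes\<close>

lemma cyc_ideal_eq: "cyc_ideal q = {f. Polynomial.monom 1 q - 1 dvd f}"
proof -
  have "cring (class_ring :: 'a uring poly ring)" by unfold_locales
  then have "cyc_ideal q = PIdl\<^bsub>class_ring\<^esub> (Polynomial.monom 1 q - 1 :: 'a uring poly)"
    unfolding cyc_ideal_def by (subst cring.cgenideal_eq_genideal) auto
  also have "\<dots> = {f. Polynomial.monom 1 q - 1 dvd f}"
    by (auto simp: cgenideal_def dvd_def mult.commute)
  finally show ?thesis .
qed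

lemma ideal_cyc_ideal: "ideal (cyc_ideal q) (class_ring :: 'a::field uring poly ring)"
proof -
  have "ring (class_ring :: 'a uring poly ring)" by unfold_locales
  then show ?thesis unfolding cyc_ideal_def by (rule ring.genideal_ideal) simp
qed

lemma cyc_class_eq_iff: "cyc_class q f = cyc_class q g \<longleftrightarrow> cyc_eq q f g"
proof -
  have *: "cyc_class q f = {h. cyc_eq q h f}" for f :: "'a uring poly"
  proof -
    have "cyc_class q f = (\<lambda>i. i + f) ` cyc_ideal q"
      by (auto simp: cyc_class_def a_r_coset_def r_coset_def)
    also have "\<dots> = {h. cyc_eq q h f}"
      by (auto simp: cyc_ideal_eq cyc_eq_def intro: rev_image_eqI)
    finally show ?thesis .
  qed
  show ?thesis unfolding * using cyc_eq_refl cyc_eq_sym cyc_eq_trans by blast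
qed

text \<open>In a commutative ring a singleton generates the set of its multiples, and cosets
  multiply through representatives. Ideal membership thereby becomes a statement about
  \<open>cyc_eq\<close>.\<close>

lemma cyc_class_mem_principal:
  "cyc_class q f \<in> Idl\<^bsub>cyc_ring q\<^esub> {cyc_class q g} \<longleftrightarrow> (\<exists>h. cyc_eq q f (h * g))"
proof -
  have cr: "cring (class_ring :: 'a uring poly ring)" by unfold_locales
  have cring: "cring (cyc_ring q :: 'a uring poly set ring)"
    unfolding cyc_ring_def by (rule ideal.quotient_is_cring[OF ideal_cyc_ideal cr])
  have car: "carrier (cyc_ring q) = range (cyc_class q :: 'a uring poly \<Rightarrow> _)"
    by (auto simp: cyc_ring_def FactRing_def A_RCOSETS_def' cyc_class_def)
  have mult: "cyc_class q h \<otimes>\<^bsub>cyc_ring q\<^esub> cyc_class q g = cyc_class q (h * g)" for h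
    using ideal.rcoset_mult_add[OF ideal_cyc_ideal, of h g q]
    by (simp add: cyc_ring_def FactRing_def cyc_class_def)
  have "Idl\<^bsub>cyc_ring q\<^esub> {cyc_class q g} = PIdl\<^bsub>cyc_ring q\<^esub> (cyc_class q g)"
    by (rule cring.cgenideal_eq_genideal[OF cring, symmetric]) (simp add: car)
  also have "\<dots> = {cyc_class q (h * g) | h. True}"
    unfolding cgenideal_def car using mult by auto
  finally show ?thesis by (auto simp: cyc_class_eq_iff)
qed

section \<open>Words as polynomials, and their scalar products\<close>

definition vec_poly :: "nat \<Rightarrow> 'a::comm_ring_1 vec \<Rightarrow> 'a poly" where
  "vec_poly q c = (\<Sum>i<q. Polynomial.monom (c $ i) i)"

lemma code_of_principal_ideal:
  "code_of_ideal q (Idl\<^bsub>cyc_ring q\<^esub> {cyc_class q g})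
    = {c \<in> carrier_vec q. \<exists>h. cyc_eq q (vec_poly q c) (h * g)}"
  by (simp add: code_of_ideal_def cyc_class_mem_principal vec_poly_def)

lemma poly_vec_poly_1: "c \<in> carrier_vec q \<Longrightarrow> poly (vec_poly q c) 1 = (\<Sum>i<q. c $ i)"
  by (simp add: vec_poly_def poly_sum poly_monom)

lemma cyc_eq_poly_1: "cyc_eq q f g \<Longrightarrow> poly f 1 = poly g 1"
  by (auto simp: cyc_eq_def poly_monom elim!: dvdE dest!: arg_cong[of _ _ "\<lambda>p. poly p 1"])

text \<open>The monomial x^((q-1)k) is x^(-k) modulo x^q - 1, so it shifts position \<open>k\<close>
  to position 0.\<close>

lemma cyc_coeff_mult_monom:
  assumes "k < q"
  shows "cyc_coeff q 0 (f * Polynomial.monom 1 ((q - 1) * k)) = cyc_coeff q k f"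
proof (induction f rule: poly_monom_induct)
  case (monom a n)
  \<comment> \<open>The integers avoid truncated subtraction in \<open>n - k\<close>.\<close>
  have "int (n + (q - 1) * k) = int n - int k + int q * int k"
    using assms by (cases q) (simp_all add: algebra_simps)
  then have "int q dvd int (n + (q - 1) * k) \<longleftrightarrow> int q dvd int n - int k"
    by (metis dvd_add_left_iff dvd_triv_left)
  then have "(n + (q - 1) * k) mod q = 0 \<longleftrightarrow> n mod q = k"
    using assms by (metis cong_def cong_iff_dvd_diff cong_int_iff dvd_eq_mod_eq_0 mod_less of_nat_dvd_iff)
  then show ?case by (simp add: mult_monom)
next
  case (add f g)
  then show ?case by (simp add: distrib_right)
qed

text \<open>The constant term of c(x) d(1/x) collects exactly the products of entries at equal
  positions. Orthogonality thus becomes a question about products modulo x^q - 1.\<close>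

lemma scalar_prod_eq_cyc_coeff:
  assumes "c \<in> carrier_vec q" "d \<in> carrier_vec q"
  shows "c \<bullet> d = cyc_coeff q 0 (vec_poly q c * cyc_rev q (vec_poly q d))"
proof -
  have "cyc_coeff q 0 (vec_poly q c * cyc_rev q (vec_poly q d))
      = (\<Sum>j<q. cyc_coeff q 0 (vec_poly q c * [:d $ j:] * Polynomial.monom 1 ((q - 1) * j)))"
    unfolding vec_poly_def[of q d] cyc_rev_sum cyc_rev_monom sum_distrib_left cyc_coeff_sum
    by (intro sum.cong refl arg_cong[of _ _ "cyc_coeff q 0"]) (simp add: smult_monom flip: mult_smult_right)
  also have "\<dots> = (\<Sum>j<q. cyc_coeff q j (vec_poly q c * [:d $ j:]))"
    by (intro sum.cong refl cyc_coeff_mult_monom) simp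
  also have "\<dots> = (\<Sum>j<q. \<Sum>i<q. if i = j then c $ i * d $ j else 0)"
    unfolding vec_poly_def sum_distrib_right cyc_coeff_sum
    by (intro sum.cong refl) (simp add: smult_monom mult.commute)
  also have "\<dots> = c \<bullet> d"
    using assms by (simp add: scalar_prod_def atLeast0LessThan)
  finally show ?thesis by simp
qed

lemma cyc_eq_0I:
  assumes "q > 0" "\<And>k. k < q \<Longrightarrow> cyc_coeff q k f = 0"
  shows "cyc_eq q f 0"
  using cyc_eq_reduced[OF assms(1), of f] assms(2) by simp

section \<open>Duals of spans\<close>

context vec_module
begin

lemma submodule_dual_code: 
  assumes "S \<subseteq> carrier_vec n"
  shows "submodule class_ring (dual_code n S) V"
proof (rule submodule.intro)
  show "module class_ring V" by (rule module_axioms)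
qed (use assms in \<open>auto simp: dual_code_def module_vec_simps add_scalar_prod_distrib[where n = n] subset_iff\<close>)

text \<open>The words orthogonal to a fixed \<open>v\<close> form a submodule, so once they include
  \<open>S\<close> they include its span.\<close>

lemma dual_code_span:
  assumes S: "S \<subseteq> carrier_vec n"
  shows "dual_code n (span S) = dual_code n S"
proof
  show "dual_code n (span S) \<subseteq> dual_code n S"
    using in_own_span[of S] S by (auto simp: dual_code_def)
  show "dual_code n S \<subseteq> dual_code n (span S)"
  proof
    fix v assume v: "v \<in> dual_code n S"
    then have vc: "v \<in> carrier_vec n" by (simp add: dual_code_def)
    have "S \<subseteq> dual_code n {v}"
      using v S by (auto simp: dual_code_def subset_iff comm_scalar_prod[where n = n])
    then have "span S \<subseteq> dual_code n {v}"
      using span_is_subset submodule_dual_code[of "{v}"] vc by simp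
    then show "v \<in> dual_code n (span S)"
      using vc by (auto simp: dual_code_def subset_iff comm_scalar_prod[where n = n])
  qed
qed

text \<open>Reduces self-duality of a span to its generators: they are pairwise orthogonal, and
  every word orthogonal to all of them lies in the span.\<close>

lemma self_dual_spanI:
  assumes "S \<subseteq> dual_code n S" "dual_code n S \<subseteq> span S"
  shows "self_dual n (span S)"
proof -
  have S: "S \<subseteq> carrier_vec n" using assms(1) by (auto simp: dual_code_def)
  have "span S \<subseteq> dual_code n S" using span_is_subset submodule_dual_code[OF S] assms(1) by simp
  then show ?thesis unfolding self_dual_def dual_code_span[OF S] using assms(2) by auto
qed

end

section \<open>Self-duality of extended cyclic codes\<close>

text \<open>A word \<open>v\<close> orthogonal to the ideal of \<open>E\<close> satisfies \<open>v \<cdot> rev E = 0\<close>, hence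
  \<open>v = v E + k v J = v E + k v(1) J\<close>: it is a codeword plus a constant word, and orthogonality to the
  extra generator then forces its coordinate at \<open>\<infinity>\<close>.\<close>

lemma self_dual_extended_cyclic_code:
  fixes E :: "'a::comm_ring_1 poly" and k \<rho> :: 'a
  assumes "q > 0"
    and orth: "cyc_eq q (E * cyc_rev q E) 0"
    and compl: "cyc_eq q (E + cyc_rev q E + [:k:] * ones_poly q) 1"
    and E1: "poly E 1 = 0"
    and k: "of_nat q * k = 1"
    and \<rho>: "\<rho> ^ 2 = - of_nat q"
  defines "C \<equiv> {c \<in> carrier_vec q. \<exists>h. cyc_eq q (vec_poly q c) (h * E)}"
  shows "self_dual (q + 1) (LinearCombinations.module.span class_ring (module_vec TYPE('a) (q + 1))
    (vCons 0 ` C \<union> {vCons \<rho> (vec q (\<lambda>_. 1))}))"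
proof -
  interpret vec_module "TYPE('a)" "q + 1" .
  let ?P = "vec_poly q" and ?J = "ones_poly q :: 'a poly" and ?one = "vec q (\<lambda>_. 1) :: 'a vec"
  let ?S = "vCons 0 ` C \<union> {vCons \<rho> ?one}"
  have scalar_one: "?one \<bullet> c = poly (?P c) 1" if "c \<in> carrier_vec q" for c
    using that by (simp add: poly_vec_poly_1 scalar_prod_def atLeast0LessThan)
  have one_one: "?one \<bullet> ?one = of_nat q"
    by (simp add: scalar_prod_def)
  have C_one: "?one \<bullet> c = 0" if "c \<in> C" for c
    using that E1 scalar_one[of c] by (auto simp: C_def dest!: cyc_eq_poly_1)
  have C_C: "c \<bullet> d = 0" if "c \<in> C" "d \<in> C" for c d
  proof -
    obtain h h' where h: "cyc_eq q (?P c) (h * E)" "cyc_eq q (?P d) (h' * E)"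
      using \<open>c \<in> C\<close> \<open>d \<in> C\<close> by (auto simp: C_def)
    have "cyc_eq q (?P c * cyc_rev q (?P d)) ((h * E) * (cyc_rev q h' * cyc_rev q E))"
      using cyc_eq_mult[OF h(1) cyc_eq_rev[OF h(2)]] by (simp add: cyc_rev_mult)
    also have "(h * E) * (cyc_rev q h' * cyc_rev q E) = (h * cyc_rev q h') * (E * cyc_rev q E)"
      by (simp only: ac_simps)
    also have "cyc_eq q \<dots> ((h * cyc_rev q h') * 0)"
      by (rule cyc_eq_mult[OF cyc_eq_refl orth])
    finally have "cyc_coeff q 0 (?P c * cyc_rev q (?P d)) = 0"
      using cyc_coeff_cong[of q _ 0 0] by simp
    then show ?thesis
      using that by (simp add: C_def scalar_prod_eq_cyc_coeff[of c q d])
  qed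
  have C_carrier: "C \<subseteq> carrier_vec q" by (auto simp: C_def)
  have S_carrier: "?S \<subseteq> carrier_vec (q + 1)" using C_carrier by auto
  have "?S \<subseteq> dual_code (q + 1) ?S"
  proof -
    have "v \<bullet> w = 0" if "v \<in> ?S" "w \<in> ?S" for v w
    proof -
      \<comment> \<open>Codewords have coordinate sum 0 because E(1) = 0. The extra generator is
        orthogonal to itself since \<open>\<rho> ^ 2\<close> cancels the sum of its \<open>q\<close>
        ones.\<close>
      have "c \<bullet> ?one = 0" if "c \<in> C" for c
        using C_one[OF that] that C_carrier by (subst comm_scalar_prod[where n = q]) auto
      then show ?thesis
        using that C_one C_C one_one \<rho> by (auto simp: power2_eq_square)
    qed
    then show ?thesis using S_carrier unfolding dual_code_def by blast
  qed
  moreover have "dual_code (q + 1) ?S \<subseteq> span ?S"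
  proof
    fix w assume w: "w \<in> dual_code (q + 1) ?S"
    then have "dim_vec w = Suc q" by (simp add: dual_code_def)
    define a where "a = w $ 0"
    define v where "v = vec q (\<lambda>i. w $ Suc i)"
    have "w = vCons a v"
      using \<open>dim_vec w = Suc q\<close> by (intro eq_vecI) (auto simp: a_def v_def vec_index_vCons)
    then have av: "w = vCons a v" "v \<in> carrier_vec q"
      by (simp_all add: v_def)
    have v_C: "v \<bullet> c = 0" if "c \<in> C" for c
      using w that by (auto simp: dual_code_def av)
    have v_one: "a * \<rho> + poly (?P v) 1 = 0"
      using w scalar_one[OF av(2)] comm_scalar_prod[OF av(2), of ?one]
      by (auto simp: dual_code_def av)
    have vE: "cyc_eq q (?P v * cyc_rev q E) 0"
    proof (rule cyc_eq_0I[OF \<open>q > 0\<close>])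
      fix j assume "j < q"
      \<comment> \<open>Pairing \<open>v\<close> with the codeword of the shift x^j E reads off the
        \<open>j\<close>-th coefficient of v rev(E).\<close>
      let ?f = "Polynomial.monom 1 j * E"
      let ?c = "vec q (\<lambda>i. cyc_coeff q i ?f)"
      have "?P ?c = (\<Sum>i<q. Polynomial.monom (cyc_coeff q i ?f) i)"
        by (simp add: vec_poly_def)
      then have c: "cyc_eq q (?P ?c) ?f"
        using cyc_eq_sym[OF cyc_eq_reduced[OF \<open>q > 0\<close>]] by simp
      then have "?c \<in> C" by (auto simp: C_def)
      then have "0 = cyc_coeff q 0 (?P v * cyc_rev q (?P ?c))"
        using v_C[of ?c] av(2) by (simp add: scalar_prod_eq_cyc_coeff)
      also have "\<dots> = cyc_coeff q 0 (?P v * cyc_rev q ?f)"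
        by (intro cyc_coeff_cong cyc_eq_mult cyc_eq_refl cyc_eq_rev c)
      also have "?P v * cyc_rev q ?f = (?P v * cyc_rev q E) * Polynomial.monom 1 ((q - 1) * j)"
        by (simp add: cyc_rev_mult cyc_rev_monom ac_simps)
      also have "cyc_coeff q 0 \<dots> = cyc_coeff q j (?P v * cyc_rev q E)"
        by (rule cyc_coeff_mult_monom[OF \<open>j < q\<close>])
      finally show "cyc_coeff q j (?P v * cyc_rev q E) = 0" by simp
    qed
    \<comment> \<open>\<open>s\<close> is the scalar for which k v J is congruent to s J, that is,
      the entry of the constant word to be split off from \<open>v\<close>.\<close>
    define s where "s = k * poly (?P v) 1"
    let ?c = "v - s \<cdot>\<^sub>v ?one"
    \<comment> \<open>Orthogonality to the extra generator reads \<open>a * \<rho>\<close> = -v(1);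
      multiplying by \<open>- \<rho> * k\<close> isolates \<open>a\<close>, because
      \<open>\<rho> ^ 2\<close> is -q and \<open>k\<close> inverts \<open>q\<close>.\<close>
    have a: "a = s * \<rho>"
    proof -
      have "a = a * (of_nat q * k)" by (simp add: k)
      also have "\<dots> = - (a * \<rho>) * \<rho> * k"
        using \<rho> by (simp add: power2_eq_square mult.assoc minus_equation_iff[of "\<rho> * \<rho>"])
      also have "- (a * \<rho>) = poly (?P v) 1"
        using v_one by (simp add: neg_eq_iff_add_eq_0)
      finally show ?thesis by (simp add: s_def ac_simps)
    qed
    have "?P ?c = ?P v - [:s:] * ?J"
      using av(2) by (simp add: vec_poly_def ones_poly_def smult_sum2 smult_monom
          sum_subtractf[symmetric] diff_monom)
    \<comment> \<open>Multiplying the complement identity by \<open>v\<close> removes the term with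
      rev(E) and leaves v - s J congruent to v E, a codeword.\<close>
    have "cyc_eq q (?P v * (E + cyc_rev q E + [:k:] * ?J)) (?P v * 1)"
      by (intro cyc_eq_mult cyc_eq_refl compl)
    from cyc_eq_sym[OF this]
    have 1: "cyc_eq q (?P v) (?P v * E + ?P v * cyc_rev q E + [:k:] * (?P v * ?J))"
      by (simp add: algebra_simps)
    have 2: "cyc_eq q ([:k:] * (?P v * ?J)) ([:k:] * ([:poly (?P v) 1:] * ?J))"
      by (intro cyc_eq_mult cyc_eq_refl cyc_eq_mult_ones_poly)
    have "cyc_eq q (?P v) (?P v * E + 0 + [:k:] * ([:poly (?P v) 1:] * ?J))"
      by (rule cyc_eq_trans[OF 1]) (intro cyc_eq_add cyc_eq_refl vE 2)
    then have "cyc_eq q (?P v - [:s:] * ?J) (?P v * E)"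
      by (simp add: cyc_eq_def s_def algebra_simps)
    then have "?c \<in> C"
      using av(2) \<open>?P ?c = _\<close> by (auto simp: C_def)
    then have "vCons 0 ?c \<in> span ?S" "vCons \<rho> ?one \<in> span ?S"
      using in_own_span[of ?S] S_carrier by auto
    moreover have "submodule class_ring (span ?S) V"
      by (rule span_is_submodule) (use S_carrier in simp)
    ultimately have "vCons 0 ?c + s \<cdot>\<^sub>v vCons \<rho> ?one \<in> span ?S"
      using submodule.m_closed[of class_ring "span ?S" V] submodule.smult_closed[of class_ring "span ?S" V]
      by (simp add: module_vec_simps)
    also have "vCons 0 ?c + s \<cdot>\<^sub>v vCons \<rho> ?one = w"
      unfolding av(1) a using av(2) by (intro eq_vecI) (auto simp: vec_index_vCons)
    finally show "w \<in> span ?S" .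
  qed
  ultimately show ?thesis by (rule self_dual_spanI)
qed

section \<open>The generators\<close>

text \<open>Both x^q - 1 and J vanish at \<open>\<alpha>\<close>, the latter because
  (\<open>\<alpha>\<close> - 1) J(\<open>\<alpha>\<close>) = 0 and \<open>\<alpha>\<close> is not
  1.\<close>

lemma Legendre_Gauss_sum_square:
  fixes \<alpha> :: "'a::field"
  assumes "prime q" "q mod 4 = 3" "primitive_root_of_unity q \<alpha>"
  shows "(\<Sum>i = 1..q - 1. of_int (Legendre (int i) (int q)) * \<alpha> ^ i)\<^sup>2 = - of_nat q"
proof -
  have "1 < q" using assms(1) by (rule prime_gt_1_nat)
  have "\<alpha> ^ q = 1" "\<alpha> \<noteq> 1"
    using assms(3) \<open>1 < q\<close> power_one_right[of \<alpha>] by (auto simp: primitive_root_of_unity_def)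
  then have "poly (ones_poly q) \<alpha> = 0"
    using power_diff_1_eq[of \<alpha> q] by (simp add: ones_poly_def poly_sum poly_monom)
  moreover have "{1..q - 1} = {1..<q}" by auto
  then have "(\<Sum>i = 1..q - 1. of_int (Legendre (int i) (int q)) * \<alpha> ^ i) = poly (Legendre_poly q) \<alpha>"
    by (simp add: Legendre_poly_def poly_sum poly_monom)
  moreover obtain h where
    "Legendre_poly q * Legendre_poly q - (ones_poly q - of_nat q) = (Polynomial.monom (1::'a) q - 1) * h"
    using Legendre_poly_square[OF assms(1,2), where ?'a = 'a] unfolding cyc_eq_def dvd_def by blast
  from arg_cong[OF this, of "\<lambda>f. poly f \<alpha>"]
  have "poly (Legendre_poly q) \<alpha> * poly (Legendre_poly q) \<alpha> - (poly (ones_poly q) \<alpha> - of_nat q) = 0"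
    using \<open>\<alpha> ^ q = 1\<close> by (simp add: poly_monom)
  ultimately show ?thesis by (simp add: power2_eq_square eq_neg_iff_add_eq_0)
qed

text \<open>In the algebraic closure the sum and \<open>to_ac r\<close> have the same square, so the
  sum is plus or minus \<open>to_ac r\<close>. It therefore lies in the range of
  \<open>to_ac\<close>, where \<open>of_ac\<close> inverts the embedding instead of returning its
  default 0.\<close>

lemma gauss_sum_square:
  fixes r :: "'a::field" and \<alpha> :: "'a alg_closure"
  assumes "prime q" "q mod 4 = 3" "primitive_root_of_unity q \<alpha>" and r: "r ^ 2 = - of_nat q"
  shows "gauss_sum q \<alpha> ^ 2 = - of_nat q"
proof -
  define s where "s = (\<Sum>i = 1..q - 1. of_int (Legendre (int i) (int q)) * \<alpha> ^ i)"
  have "s\<^sup>2 = - of_nat q"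
    unfolding s_def by (rule Legendre_Gauss_sum_square[OF assms(1-3)])
  also have "\<dots> = (to_ac r)\<^sup>2"
    by (metis r to_ac_minus to_ac_of_nat to_ac_power)
  finally have "s = to_ac r \<or> s = to_ac (- r)"
    by (simp add: power2_eq_iff)
  then have "gauss_sum q \<alpha> = r \<or> gauss_sum q \<alpha> = - r"
    unfolding gauss_sum_def s_def[symmetric] using of_ac_to_ac by metis
  then show ?thesis using r by auto
qed

section \<open>Base field constants in the ring \<open>uring\<close>, and the polynomials built from
  them\<close>

lemma uconst_add: "uconst (a + b) = uconst a + uconst b"
  by transfer simp

lemma uconst_mult: "uconst (a * b) = uconst a * uconst b"
  by transfer simp

lemma uconst_1 [simp]: "uconst 1 = 1"
  by transfer (simp add: one_pCons)

lemma uconst_0 [simp]: "uconst 0 = 0"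
  by transfer simp

interpretation uconst_hom: comm_ring_hom uconst
  by unfold_locales (simp_all add: uconst_add uconst_mult)

interpretation map_poly_uconst_hom: map_poly_comm_ring_hom uconst ..

lemma map_poly_uconst_ones_poly: "map_poly uconst (ones_poly q) = ones_poly q"
  by (simp add: ones_poly_def map_poly_uconst_hom.hom_sum map_poly_monom)

lemma map_poly_uconst_Legendre_poly: "map_poly uconst (Legendre_poly q) = Legendre_poly q"
  by (simp add: Legendre_poly_def map_poly_uconst_hom.hom_sum map_poly_monom uconst_hom.hom_of_int)

lemma ones_Legendre_poly_j1_j2:
  assumes "q > 0"
  shows "ones_poly q = (1 + j1 q + j2 q :: 'a::field poly)"
    and "Legendre_poly q = (j1 q - j2 q :: 'a poly)"
proof -
  have un: "{1..<q} = quad_residues q \<union> quad_nonresidues q"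
    and dj: "quad_residues q \<inter> quad_nonresidues q = {}"
    and fin: "finite (quad_residues q)" "finite (quad_nonresidues q)"
    by (auto simp: quad_residues_def quad_nonresidues_def)
  show "ones_poly q = (1 + j1 q + j2 q :: 'a poly)"
    unfolding ones_poly_split[OF assms] un sum.union_disjoint[OF fin dj] j1_def j2_def by simp
  have "Legendre (int i) (int q) = 1" if "i \<in> quad_residues q" for i
    using that by (auto simp: Legendre_def quad_residues_def cong_iff_dvd_diff nat_dvd_not_less)
  moreover have "Legendre (int i) (int q) = -1" if "i \<in> quad_nonresidues q" for i
    using that by (auto simp: Legendre_def quad_nonresidues_def cong_iff_dvd_diff nat_dvd_not_less)
  ultimately show "Legendre_poly q = (j1 q - j2 q :: 'a poly)"
    unfolding Legendre_poly_def un sum.union_disjoint[OF fin dj] j1_def j2_def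
    by (simp add: sum_negf flip: minus_monom)
qed

text \<open>The parts with 1/q have equal signs on \<open>j1\<close> and \<open>j2\<close> and
  combine to J; the parts with 1/\<open>\<theta>\<close> have opposite signs and combine to L. The
  two idempotents differ only in the sign of L.\<close>

lemma e1_e2:
  fixes \<theta> :: "'a::field"
  assumes "q > 0" "of_nat q \<noteq> (0::'a)" "(2::'a) \<noteq> 0"
  defines "A \<equiv> [:1/2:] * (1 - [:1 / of_nat q:] * ones_poly q)" and "B \<equiv> [:1 / (2 * \<theta>):] * Legendre_poly q"
  shows "e1 q \<theta> = A - B" "e2 q \<theta> = A + B"
proof -
  have "Polynomial.smult a (1 :: 'a poly) = [:a:]" for a by simp
  then show "e1 q \<theta> = A - B" "e2 q \<theta> = A + B"
    unfolding A_def B_def e1_def e2_def ones_Legendre_poly_j1_j2[OF assms(1)]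
    by (simp_all add: smult_add_right smult_diff_right smult_add_left smult_diff_left algebra_simps
        flip: pCons_one)
qed

text \<open>Each \<open>eta\<close> is idempotent, the first is orthogonal to the other three, and
  sums of orthogonal idempotents and complements of idempotents are again idempotent.\<close>

lemma qr_gen_idempotent_combination:
  fixes \<xi> :: "'a::field"
  assumes "i \<in> {1..14}" "\<xi> ^ 3 = 1" "(3::'a) \<noteq> 0"
  obtains f where "f * f = f"
    and "qr_gen q \<xi> \<theta> i = [:f:] * map_poly uconst (e1 q \<theta>) + [:1 - f:] * map_poly uconst (e2 q \<theta>)"
proof -
  \<comment> \<open>The second to fourth \<open>eta\<close> are one expression evaluated at the cube
    roots of unity 1, \<open>\<xi>\<close> and \<open>\<xi> ^ 2\<close>.\<close>
  let ?w = "\<lambda>j :: nat. if j = 2 then 1 else if j = 3 then \<xi> else \<xi> ^ 2"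
  let ?\<eta> = "\<lambda>w :: 'a. uconst (inverse 3) * (uconst w * u + uconst w ^ 2 * u ^ 2 + u ^ 3)"
  define v :: "'a uring" where "v = 1 - u ^ 3"
  have u5: "u ^ 5 = (u ^ 2 :: 'a uring)" and u6: "u ^ 6 = (u ^ 3 :: 'a uring)"
    using u_pow4[where ?'a = 'a] by (simp_all add: eval_nat_numeral)
  have v: "v * v = v"
    using u6 by (simp add: v_def algebra_simps flip: power_add)
  \<comment> \<open>Since u^4 = u, \<open>v\<close> annihilates \<open>u\<close>, hence all its
    positive powers and every \<open>?\<eta> w\<close>.\<close>
  have "v * u = 0"
    using u_pow4[where ?'a = 'a] by (simp add: v_def algebra_simps eval_nat_numeral)
  then have vu: "v * u ^ Suc n = 0" for n
    by (simp flip: mult.assoc)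
  have vw: "v * ?\<eta> w = 0" for w
    using vu[of 0] vu[of 1] vu[of 2] by (simp add: distrib_left mult.left_commute[of v] numeral_eq_Suc)
  have w_idem: "?\<eta> w * ?\<eta> w = ?\<eta> w" if "w ^ 3 = 1" for w
  proof -
    let ?W = "uconst w" and ?t = "uconst (inverse 3) :: 'a uring"
    have W3: "?W ^ 3 = 1" using that by (metis uconst_hom.hom_power uconst_1)
    then have W4: "?W ^ 4 = ?W" by (simp add: eval_nat_numeral)
    have "?t * 3 = uconst (inverse 3 * 3)" by (simp only: uconst_mult uconst_hom.hom_numeral)
    then have t: "?t * 3 = 1" using assms(3) by simp
    \<comment> \<open>With w^3 = 1 and u^4 = u the squares permute the three terms and the doubled
      cross terms give each of them twice more. One of the two factors 1/3 cancels the resulting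
      3.\<close>
    have "(?W * u + ?W ^ 2 * u ^ 2 + u ^ 3) * (?W * u + ?W ^ 2 * u ^ 2 + u ^ 3)
        = ?W ^ 2 * u ^ 2 + ?W ^ 4 * u ^ 4 + u ^ 6 + 2 * (?W ^ 3 * u ^ 3 + ?W * u ^ 4 + ?W ^ 2 * u ^ 5)"
      by (simp add: algebra_simps eval_nat_numeral)
    also have "\<dots> = 3 * (?W * u + ?W ^ 2 * u ^ 2 + u ^ 3)"
      by (simp add: W3 W4 u5 u6 u_pow4)
    finally have "?\<eta> w * ?\<eta> w = (?t * 3) * ?\<eta> w"
      by (simp add: mult.assoc mult.left_commute)
    then show ?thesis by (simp only: t mult_1_left)
  qed
  have eta1: "eta \<xi> 1 = v" by (simp add: eta_def v_def)
  \<comment> \<open>At w = \<open>\<xi> ^ 2\<close> the coefficient w^2 of u^2 is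
    \<open>\<xi> ^ 4\<close>, while \<open>eta\<close> has \<open>\<xi>\<close> there.\<close>
  have "\<xi> ^ 4 = \<xi>" using assms(2) by (simp add: eval_nat_numeral)
  then have \<xi>4: "uconst \<xi> ^ 4 = uconst \<xi>" by (metis uconst_hom.hom_power)
  have eta: "eta \<xi> j = ?\<eta> (?w j)" if "j \<in> {2, 3, 4}" for j
    using that \<xi>4 by (auto simp: eta_def uconst_hom.hom_power simp flip: power_mult)
  have "(\<xi> ^ 2) ^ 3 = 1"
    using assms(2) by (metis mult.commute power_mult power_one)
  then have w3: "(?w j) ^ 3 = 1" for j
    using assms(2) by simp
  have idem: "eta \<xi> j * eta \<xi> j = eta \<xi> j" if "j \<in> {1..4}" for j
  proof (cases "j = 1")
    case True
    then show ?thesis by (simp only: eta1 v)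
  next
    case False
    then have "j \<in> {2, 3, 4}" using that by auto
    then show ?thesis unfolding eta[OF \<open>j \<in> {2, 3, 4}\<close>] by (intro w_idem w3)
  qed
  have idem': "(eta \<xi> 1 + eta \<xi> j) * (eta \<xi> 1 + eta \<xi> j) = eta \<xi> 1 + eta \<xi> j" if "j \<in> {2, 3, 4}" for j
  proof -
    have "eta \<xi> 1 * eta \<xi> j = 0" unfolding eta1 eta[OF that] by (rule vw)
    moreover have "j \<in> {1..4}" using that by auto
    ultimately show ?thesis
      using idem[of 1] idem[of j] by (simp add: distrib_left distrib_right mult.commute)
  qed
  have compl: "(1 - f) * (1 - f) = 1 - f" if "f * f = f" for f :: "'a uring"
    using that by (simp add: algebra_simps)
  \<comment> \<open>\<open>f\<close> is always the coefficient of \<open>e1\<close>, hence a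
    complement in the first and the last range.\<close>
  consider "i \<in> {1..4}" | "i \<in> {5..8}" | "i \<in> {9..11}" | "i \<in> {12..14}"
    using assms(1) by fastforce
  then show ?thesis
  proof cases
    case 1
    then show ?thesis
      by (intro that[of "1 - eta \<xi> i"] compl idem) (auto simp: qr_gen_def Let_def)
  next
    case 2
    then have "i - 4 \<in> {1..4}" by auto
    with 2 show ?thesis
      by (intro that[of "eta \<xi> (i - 4)"] idem) (auto simp: qr_gen_def Let_def)
  next
    case 3
    then have "i - 7 \<in> {2, 3, 4}" by auto
    with 3 show ?thesis
      by (intro that[of "eta \<xi> 1 + eta \<xi> (i - 7)"] idem') (auto simp: qr_gen_def Let_def algebra_simps)
  next
    case 4
    then have "i - 10 \<in> {2, 3, 4}" by auto
    with 4 show ?thesis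
      by (intro that[of "1 - (eta \<xi> 1 + eta \<xi> (i - 10))"] compl idem')
        (auto simp: qr_gen_def Let_def algebra_simps)
  qed
qed

text \<open>The combination equals A - (2f - 1) T L, where T is the constant
  1/(2\<open>\<theta>\<close>). As \<open>f\<close> is idempotent, (2f - 1)^2 = 1, so the square of
  the coefficient of L is the same for all fourteen generators.\<close>

lemma qr_gen_eq:
  fixes \<theta> \<xi> :: "'a::field"
  assumes "i \<in> {1..14}" "\<xi> ^ 3 = 1" "(3::'a) \<noteq> 0" "(2::'a) \<noteq> 0"
    and "q > 0" "of_nat q \<noteq> (0::'a)" "\<theta> ^ 2 = - of_nat q"
  obtains g where "g ^ 2 = - (uconst (1/2) ^ 2 * uconst (1 / of_nat q))"
    and "qr_gen q \<xi> \<theta> i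
      = [:uconst (1/2):] * (1 - [:uconst (1 / of_nat q):] * ones_poly q) - [:g:] * Legendre_poly q"
proof -
  obtain f where f: "f * f = f" and
    gen: "qr_gen q \<xi> \<theta> i = [:f:] * map_poly uconst (e1 q \<theta>) + [:1 - f:] * map_poly uconst (e2 q \<theta>)"
    using qr_gen_idempotent_combination[OF assms(1-3)] by blast
  define g where "g = (2 * f - 1) * uconst (1 / (2 * \<theta>))"
  define A :: "'a uring poly" where "A = [:uconst (1/2):] * (1 - [:uconst (1 / of_nat q):] * ones_poly q)"
  define L :: "'a uring poly" where "L = Legendre_poly q"
  define T where "T = [:uconst (1 / (2 * \<theta>)):]"
  have "map_poly uconst (e1 q \<theta>) = A - T * L" "map_poly uconst (e2 q \<theta>) = A + T * L"
    unfolding e1_e2[OF assms(5,6,4)] A_def T_def L_def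
    by (simp_all only: map_poly_uconst_hom.hom_minus map_poly_uconst_hom.hom_add
        map_poly_uconst_hom.hom_mult map_poly_uconst_hom.hom_one map_poly_uconst_ones_poly
        map_poly_uconst_Legendre_poly uconst_hom.map_poly_pCons_hom map_poly_0 simp_thms)
  then have "qr_gen q \<xi> \<theta> i = [:f:] * (A - T * L) + (1 - [:f:]) * (A + T * L)"
    by (simp add: gen one_pCons)
  also have "\<dots> = A - (2 * [:f:] - 1) * T * L"
    by (simp add: algebra_simps)
  also have "(2 * [:f:] - 1) * T = [:g:]"
    by (simp add: g_def T_def one_pCons numeral_poly ac_simps)
  finally have 1: "qr_gen q \<xi> \<theta> i = A - [:g:] * L" .
  have "((2 * f - 1) * c) ^ 2 = (4 * (f * f) - 4 * f + 1) * c ^ 2" for c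
    by (simp add: power2_eq_square algebra_simps)
  then have "g ^ 2 = (4 * (f * f) - 4 * f + 1) * uconst ((1 / (2 * \<theta>)) ^ 2)"
    unfolding g_def uconst_hom.hom_power .
  also have "(1 / (2 * \<theta>)) ^ 2 = - ((1/2) ^ 2 * (1 / of_nat q))"
    using assms by (simp add: power_divide power_mult_distrib)
  finally have "g ^ 2 = - (uconst (1/2) ^ 2 * uconst (1 / of_nat q))"
    by (simp only: f uconst_hom.hom_uminus uconst_mult uconst_hom.hom_power diff_self add_0 mult_1_left)
  then show ?thesis using that 1 unfolding A_def L_def by blast
qed

text \<open>Here \<open>h\<close> is 1/2 and \<open>k\<close> is 1/q. With A = h (1 - k J) the
  product of E = A - g L and its reversal A + g L is A^2 - g^2 L^2, and both squares reduce to h^2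
  (1 - k J). In the sum the terms with L cancel.\<close>

lemma qr_idempotent:
  fixes h k g :: "'a::comm_ring_1"
  assumes q: "prime q" "q mod 4 = 3"
    and h: "2 * h = 1" and k: "of_nat q * k = 1" and g: "g ^ 2 = - (h ^ 2 * k)"
  defines "E \<equiv> [:h:] * (1 - [:k:] * ones_poly q) - [:g:] * Legendre_poly q"
  shows "cyc_eq q (E * cyc_rev q E) 0"
    and "cyc_eq q (E + cyc_rev q E + [:k:] * ones_poly q) 1"
    and "poly E 1 = 0"
proof -
  \<comment> \<open>Named constant polynomials keep the scalars as opaque ring elements during
    normalisation.\<close>
  define H K G Q where "H = [:h:]" and "K = [:k:]" and "G = [:g:]" and "Q = [:of_nat q :: 'a:]"
  define J :: "'a poly" where "J = ones_poly q"
  define L :: "'a poly" where "L = Legendre_poly q"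
  have E: "E = H * (1 - K * J) - G * L"
    by (simp only: E_def H_def K_def G_def J_def L_def)
  have KQ: "K * Q = 1" and GG: "G * G = - (H * H * K)"
    using k g by (simp_all add: K_def Q_def G_def H_def one_pCons power2_eq_square mult.commute)
  have HH: "H + H = 1"
    using h by (simp add: H_def one_pCons)
  have JJ: "cyc_eq q (J * J) (Q * J)"
    using cyc_eq_mult_ones_poly[of q "ones_poly q"] by (simp only: J_def Q_def poly_ones_poly_1)
  have LL: "cyc_eq q (L * L) (J - Q)"
    using Legendre_poly_square[OF q] by (simp only: J_def L_def Q_def of_nat_poly)
  have "cyc_eq q (cyc_rev q E) (H * (1 - K * J) - G * - L)"
    unfolding E cyc_rev_diff cyc_rev_mult cyc_rev_1 H_def K_def G_def cyc_rev_const J_def L_def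
    by (intro cyc_eq_diff cyc_eq_mult cyc_eq_refl cyc_rev_ones_poly cyc_rev_Legendre_poly q)
  then have rev: "cyc_eq q (cyc_rev q E) (H * (1 - K * J) + G * L)" by simp
  have "cyc_eq q (E * cyc_rev q E) ((H * (1 - K * J) - G * L) * (H * (1 - K * J) + G * L))"
    unfolding E by (rule cyc_eq_mult[OF cyc_eq_refl rev[unfolded E]])
  also have "\<dots> = H * H * (1 - 2 * K * J + K * K * (J * J)) - (G * G) * (L * L)"
    by (simp add: algebra_simps)
  also have "cyc_eq q \<dots> (H * H * (1 - 2 * K * J + K * K * (Q * J)) - (G * G) * (J - Q))"
    by (intro cyc_eq_diff cyc_eq_add cyc_eq_mult cyc_eq_refl JJ LL)
  also have "\<dots> = H * H * (1 - 2 * K * J + (K * Q) * (K * J)) + H * H * (K * J - K * Q)"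
    unfolding GG by (simp add: algebra_simps)
  also have "\<dots> = 0"
    unfolding KQ by (simp add: algebra_simps)
  finally show "cyc_eq q (E * cyc_rev q E) 0" .
  have "cyc_eq q (E + cyc_rev q E + K * J) (E + (H * (1 - K * J) + G * L) + K * J)"
    by (intro cyc_eq_add cyc_eq_refl rev)
  also have "\<dots> = (H + H) * (1 - K * J) + K * J"
    unfolding E by (simp add: algebra_simps)
  also have "\<dots> = 1"
    unfolding HH by simp
  finally show "cyc_eq q (E + cyc_rev q E + [:k:] * ones_poly q) 1"
    by (simp only: K_def J_def)
  show "poly E 1 = 0"
    using k by (simp add: E_def poly_ones_poly_1 poly_Legendre_poly_1[OF q] mult.commute)
qed

section \<open>Specialisation to the field with \<open>p\<close> elements\<close>

theorem theorem11:
  fixes p q :: nat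
    and \<xi> r :: "'p::prime_card mod_ring"
    and \<alpha> :: "'p mod_ring alg_closure"
    and i :: nat
  assumes "prime p" and "p mod 3 = 1" and "CARD('p) = p"
    and "prime q" and "q mod 4 = 3"
    and "\<not> q dvd p" and "QuadRes (int q) (int p)"
    and "primitive_root_of_unity 3 \<xi>"
    and "primitive_root_of_unity q \<alpha>"
    and "r ^ 2 = - of_nat q"
    and "i \<in> {1..14}"
  shows "self_dual (q + 1) (extended_qr_code q \<xi> \<alpha> r i)"
proof -
  have "q > 0" using assms(4) by (rule prime_gt_0_nat)
  have of_nat_0: "of_nat n = (0 :: 'p mod_ring) \<longleftrightarrow> p dvd n" for n
    by (simp add: of_nat_eq_0_iff_char_dvd assms(3))
  have "\<not> p dvd q" using assms(1,4,6) primes_dvd_imp_eq by blast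
  then have q0: "of_nat q \<noteq> (0 :: 'p mod_ring)" unfolding of_nat_0 .
  \<comment> \<open>\<open>p\<close> is 1 modulo 3, which excludes the primes 2 and 3.\<close>
  have "\<not> p dvd 2" "\<not> p dvd 3"
    using assms(1,2) primes_dvd_imp_eq[of p 2] primes_dvd_imp_eq[of p 3] by auto
  then have two: "(2 :: 'p mod_ring) \<noteq> 0" and three: "(3 :: 'p mod_ring) \<noteq> 0"
    using of_nat_0[of 2] of_nat_0[of 3] by simp_all
  define \<theta> where "\<theta> = gauss_sum q \<alpha>"
  have \<theta>: "\<theta> ^ 2 = - of_nat q"
    unfolding \<theta>_def by (rule gauss_sum_square[OF assms(4,5,9,10)])
  have \<xi>: "\<xi> ^ 3 = 1" using assms(8) by (simp add: primitive_root_of_unity_def)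
  let ?h = "uconst (1/2) :: 'p mod_ring uring" and ?k = "uconst (1 / of_nat q) :: 'p mod_ring uring"
  obtain g where g: "g ^ 2 = - (?h ^ 2 * ?k)"
    and gen: "qr_gen q \<xi> \<theta> i = [:?h:] * (1 - [:?k:] * ones_poly q) - [:g:] * Legendre_poly q"
    by (rule qr_gen_eq[OF assms(11) \<xi> three two \<open>q > 0\<close> q0 \<theta>])
  have "uconst (2 * (1/2)) = (1 :: 'p mod_ring uring)" using two by simp
  then have h: "2 * ?h = 1" by (simp only: uconst_mult uconst_hom.hom_numeral)
  have "uconst (of_nat q * (1 / of_nat q)) = (1 :: 'p mod_ring uring)" using q0 by simp
  then have k: "of_nat q * ?k = 1" by (simp only: uconst_mult uconst_hom.hom_of_nat)
  have r: "uconst r ^ 2 = - of_nat q"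
    by (simp only: assms(10) flip: uconst_hom.hom_power uconst_hom.hom_of_nat uconst_hom.hom_uminus)
  \<comment> \<open>The code is the extension of the ideal of E, with \<open>uconst r\<close> as the
    square root of -q at the coordinate at infinity.\<close>
  show ?thesis
    unfolding extended_qr_code_def qr_code_def code_of_principal_ideal \<theta>_def[symmetric] gen
    by (rule self_dual_extended_cyclic_code[OF \<open>q > 0\<close> qr_idempotent[OF assms(4,5) h k g] k r])
qed

end
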